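(* Let $\{G_m\}_{m\in\mathbb Z}$ be a generalized Fibonacci sequence, let $n,m,r$ be integers and let $k$ be a non-negative integer. The following identities hold. (i) If $n+r\neq 0$, then $$\sum_{j=0}^k(-1)^j\binom kj\left(\frac{F_r}{F_{r+n}}\right)^jG_{m+rk+nj}=(-1)^{rk}\left(\frac{F_n}{F_{r+n}}\right)^kG_m .$$ (ii) If $n\neq 0$, then $$\sum_{j=0}^k(-1)^{rj}\binom kj\left(\frac{F_r}{F_n}\right)^jG_{m-rk+(n+r)j}=(-1)^{rk}\left(\frac{F_{n+r}}{F_n}\right)^kG_m .$$ (iii) If $n\neq 0$, then $$\sum_{j=0}^k(-1)^j(-1)^{rj}\binom kj\left(\frac{F_{n+r}}{F_n}\right)^jG_{m-(n+r)k+rj}=(-1)^k(-1)^{rk}\left(\frac{F_r}{F_n}\right)^kG_m .$$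
   Context: A generalized Fibonacci sequence $\{G_m\}$ is defined by $G_m=G_{m-1}+G_{m-2}$ for $m\ge 2$, with arbitrary (say complex) initial values $G_0,G_1$. The case $G_0=0$, $G_1=1$ is the Fibonacci sequence $\{F_m\}$. Extension to negative indices is by $G_{-m}=(-1)^m(F_{m+1}G_0-F_mG_1)$ for $m\ge 1$, so that $G_m=G_{m-1}+G_{m-2}$ holds for all integers $m$ (in particular $F_{-m}=(-1)^{m+1}F_m$). Convention: $x^0=1$ for every $x$, including $x=0$. *)

theory Defs
  imports Complex_Main "HOL-Number_Theory.Fib"
begin

definition gen_fibonacci :: "(int \<Rightarrow> complex) \<Rightarrow> bool" where
  "gen_fibonacci G \<longleftrightarrow>
     (\<forall>m::nat. m \<ge> 2 \<longrightarrow> G (int m) = G (int m - 1) + G (int m - 2)) \<and>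
     (\<forall>m::nat. m \<ge> 1 \<longrightarrow>
        G (- int m) = (-1) ^ m * (of_nat (fib (m + 1)) * G 0 - of_nat (fib m) * G 1))"

definition fib_int :: "int \<Rightarrow> complex" where
  "fib_int m = (if m \<ge> 0 then of_nat (fib (nat m))
                else (-1) ^ (nat (- m) + 1) * of_nat (fib (nat (- m))))"

lemma fib_int_0 [simp]: "fib_int 0 = 0"
  and fib_int_1 [simp]: "fib_int 1 = 1"
  by (simp_all add: fib_int_def)

lemma gen_fibonacci_fib_int: "gen_fibonacci fib_int"
  unfolding gen_fibonacci_def
proof (intro conjI allI impI)
  fix m :: nat
  assume "m \<ge> 2"
  then obtain k where k: "m = Suc (Suc k)"
    by (auto simp: le_iff_add)
  have "int m - 1 = int (Suc k)" "int m - 2 = int k"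
    using k by simp_all
  then show "fib_int (int m) = fib_int (int m - 1) + fib_int (int m - 2)"
    unfolding fib_int_def using k by (simp only: nat_int) simp
next
  fix m :: nat
  assume "m \<ge> 1"
  then show "fib_int (- int m) =
      (-1) ^ m * (of_nat (fib (m + 1)) * fib_int 0 - of_nat (fib m) * fib_int 1)"
    by (simp add: fib_int_def)
qed

lemma gen_fibonacci_step:
  assumes "gen_fibonacci G"
  shows "G (int (Suc (Suc n))) = G (int (Suc n)) + G (int n)"
proof -
  have "G (int (Suc (Suc n))) = G (int (Suc (Suc n)) - 1) + G (int (Suc (Suc n)) - 2)"
    using assms[unfolded gen_fibonacci_def, THEN conjunct1, rule_format, of "Suc (Suc n)"]
    by (simp del: of_nat_Suc)
  moreover have "int (Suc (Suc n)) - 1 = int (Suc n)" "int (Suc (Suc n)) - 2 = int n"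
    by simp_all
  ultimately show ?thesis by metis
qed

lemma gen_fibonacci_neg:
  assumes "gen_fibonacci G" "n \<ge> 1"
  shows "G (- int n) = (-1) ^ n * (of_nat (fib (n + 1)) * G 0 - of_nat (fib n) * G 1)"
  using assms unfolding gen_fibonacci_def by blast

lemma gen_fibonacci_unique:
  assumes "gen_fibonacci G" "gen_fibonacci H" "G 0 = H 0" "G 1 = H 1"
  shows "G = H"
proof
  have nonneg: "G (int n) = H (int n) \<and> G (int (Suc n)) = H (int (Suc n))" for n
  proof (induction n)
    case 0
    then show ?case using assms by simp
  next
    case (Suc n)
    then show ?case
      using gen_fibonacci_step[OF assms(1), of n] gen_fibonacci_step[OF assms(2), of n] by metis
  qed
  fix m :: int
  show "G m = H m"
  proof (cases "m \<ge> 0")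
    case True
    then show ?thesis using nonneg[of "nat m"] by simp
  next
    case False
    define k where "k = nat (- m)"
    have k: "m = - int k" "k \<ge> 1" using False by (simp_all add: k_def)
    show ?thesis
      unfolding k(1) gen_fibonacci_neg[OF assms(1) k(2)] gen_fibonacci_neg[OF assms(2) k(2)]
        assms(3,4) by (rule refl)
  qed
qed

lemma gen_fibonacci_exists: "\<exists>G. gen_fibonacci G \<and> G 0 = a \<and> G 1 = b"
proof -
  define G :: "int \<Rightarrow> complex" where
    "G m = (if m \<ge> 1 then of_nat (fib (nat m - 1)) * a + of_nat (fib (nat m)) * b
            else (-1) ^ nat (- m) * (of_nat (fib (nat (- m) + 1)) * a - of_nat (fib (nat (- m))) * b))"
    for m
  have G0: "G 0 = a" and G1: "G 1 = b"
    by (simp_all add: G_def)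
  have "G (int m) = G (int m - 1) + G (int m - 2)" if "m \<ge> 2" for m :: nat
  proof (cases "m = 2")
    case True
    then show ?thesis by (simp add: G_def numeral_2_eq_2)
  next
    case False
    then have "m = Suc (Suc (Suc (m - 3)))" using that by arith
    then obtain k where k: "m = Suc (Suc (Suc k))" by blast
    have "int m - 1 = int (Suc (Suc k))" "int m - 2 = int (Suc k)"
      using k by simp_all
    then show ?thesis
      unfolding G_def using k by (simp only: nat_int) (simp add: algebra_simps)
  qed
  moreover have "G (- int m) = (-1) ^ m * (of_nat (fib (m + 1)) * G 0 - of_nat (fib m) * G 1)"
    if "m \<ge> 1" for m :: nat
    unfolding G0 G1 using that by (simp add: G_def)
  ultimately show ?thesis
    using G0 G1 unfolding gen_fibonacci_def by blast
qed

end

theory Submission imports Defs begin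

text \<open>
  All three identities are iterations of a single three-term relation, the
  Vajda-type identity
  \[ F_{r+n} G_{m+r} - F_r G_{m+r+n} = (-1)^r F_n G_m, \]
  proved below as \<open>gen_fibonacci_vajda\<close>. After division by $F_{r+n}$ or by $F_n$ and a shift
  of $m$, it takes the form $G_{m+s} + b\, G_{m+s+t} = c\, G_m$ for all $m$, with constants
  $b$, $c$ and shifts $s$, $t$. In terms of the shift operator $E$ on sequences this says that
  $E^s (1 + b E^t)$ acts on $G$ as multiplication by $c$. Taking the $k$-th power and
  expanding binomially (\<open>binomial_sum_of_three_term_relation\<close>) yields
  $\sum_j \binom{k}{j} b^j G_{m+sk+tj} = c^k G_m$; the parts of the theorem are the cases
  $(s, t) = (r, n)$, $(-r, n+r)$ and $(-(n+r), r)$.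

  As a function of $n$, each side of the Vajda-type identity satisfies the Fibonacci
  recurrence on all integers, so the identity needs checking only for $n = 0$, where it is
  trivial, and $n = 1$. The case $n = 1$ is a Cassini-type identity, which holds because its
  left-hand side changes sign when $r$ increases by one.
\<close>

text \<open>
  The definition states the recurrence for nonnegative indices only; on the negative side it
  comes from the recurrence of $F$ in the explicit formula, and at $i = -1$ the two
  definitions meet.
\<close>

lemma gen_fibonacci_recurrence:
  assumes "gen_fibonacci G"
  shows "G (i + 2) = G (i + 1) + G i"
proof -
  \<comment> \<open>The defining formula for negative indices also holds at index 0, so it covers all
    three terms of the recurrence as soon as \<open>i \<le> -2\<close>.\<close>
  have neg: "G (- int n) = (-1) ^ n * (of_nat (fib (n + 1)) * G 0 - of_nat (fib n) * G 1)" for n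
    using gen_fibonacci_neg[OF assms, of n] by (cases n) simp_all
  consider "i \<ge> 0" | "i = -1" | "i \<le> -2" by linarith
  then show ?thesis
  proof cases
    case 1
    then show ?thesis
      using gen_fibonacci_step[OF assms, of "nat i"] by (simp add: add.commute)
  next
    case 2
    then show ?thesis using neg[of 1] by simp
  next
    case 3
    define n where "n = nat (- i - 2)"
    have "i = - int (n + 2)" "i + 1 = - int (n + 1)" "i + 2 = - int n"
      using 3 by (simp_all add: n_def)
    then show ?thesis
      by (simp only: neg) (simp add: algebra_simps)
  qed
qed

text \<open>
  Two consecutive values determine a solution in both directions. Applied to the difference
  of two solutions, this reduces an identity between them to two indices.
\<close>

lemma fibonacci_recurrence_eq_zero:
  fixes H :: "int \<Rightarrow> 'a :: ab_group_add"
  assumes rec: "\<And>i. H (i + 2) = H (i + 1) + H i" and "H 0 = 0" "H 1 = 0"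
  shows "H i = 0"
proof -
  have "H i = 0 \<and> H (i + 1) = 0"
  proof (induction i rule: int_induct[where k = 0])
    case base
    then show ?case using assms by simp
  next
    case (step1 i)
    then show ?case using rec[of i] by (simp add: add.assoc)
  next
    case (step2 i)
    then show ?case using rec[of "i - 1"] by (simp add: algebra_simps)
  qed
  then show ?thesis ..
qed

text \<open>
  By the recurrence, the left-hand side at $r+1$ is
  $(F_{r+1} + F_r) G_{m+r+1} - F_{r+1} (G_{m+r+1} + G_{m+r})$, the negative of its value
  at $r$; at $r = 0$ it is $G_m$.
\<close>

lemma gen_fibonacci_cassini:
  assumes "gen_fibonacci G"
  shows "fib_int (r + 1) * G (m + r) - fib_int r * G (m + r + 1) = (-1) powi r * G m"
proof -
  define D where "D r = fib_int (r + 1) * G (m + r) - fib_int r * G (m + r + 1)" for r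
  have alternates: "D (r + 1) = - D r" for r
    using gen_fibonacci_recurrence[OF assms, of "m + r"]
      gen_fibonacci_recurrence[OF gen_fibonacci_fib_int, of r]
    by (simp add: D_def algebra_simps)
  have "D r = (-1) powi r * G m"
  proof (induction r rule: int_induct[where k = 0])
    case base
    then show ?case by (simp add: D_def)
  next
    case (step1 i)
    then show ?case using alternates[of i] by (simp add: power_int_add)
  next
    case (step2 i)
    then show ?case using alternates[of "i - 1"] by (simp add: power_int_diff)
  qed
  then show ?thesis by (simp add: D_def)
qed

lemma gen_fibonacci_vajda:
  assumes "gen_fibonacci G"
  shows "fib_int (r + n) * G (m + r) - fib_int r * G (m + r + n) = (-1) powi r * fib_int n * G m"
proof -
  define H where
    "H n = fib_int (r + n) * G (m + r) - fib_int r * G (m + r + n) - (-1) powi r * fib_int n * G m"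
    for n
  have "H n = 0"
  proof (rule fibonacci_recurrence_eq_zero)
    fix i
    show "H (i + 2) = H (i + 1) + H i"
      using gen_fibonacci_recurrence[OF assms, of "m + r + i"]
        gen_fibonacci_recurrence[OF gen_fibonacci_fib_int, of "r + i"]
        gen_fibonacci_recurrence[OF gen_fibonacci_fib_int, of i]
      by (simp add: H_def algebra_simps)
  next
    show "H 0 = 0" by (simp add: H_def)
  next
    show "H 1 = 0" using gen_fibonacci_cassini[OF assms, of r m] by (simp add: H_def)
  qed
  then show ?thesis by (simp add: H_def)
qed

lemma fib_int_nonzero: "n \<noteq> 0 \<Longrightarrow> fib_int n \<noteq> 0"
  by (auto simp: fib_int_def fib_neq_0_nat)

text \<open>
  The operator identity $(E^s (1 + b E^t))^k = \sum_j \binom{k}{j} b^j E^{sk+tj}$, read off on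
  an eigenvector of $E^s (1 + b E^t)$. In the induction on $k$, Pascal's rule splits the sum
  for $k+1$ into the sums for $k$ at $m+s$ and, with weight $b$, at $m+s+t$.
\<close>

lemma binomial_sum_of_three_term_relation:
  fixes G :: "int \<Rightarrow> 'a :: comm_ring_1"
  assumes rel: "\<And>m. G (m + s) + b * G (m + s + t) = c * G m"
  shows "(\<Sum>j=0..k. of_nat (k choose j) * b ^ j * G (m + s * int k + t * int j)) = c ^ k * G m"
proof (induction k arbitrary: m)
  case 0
  then show ?case by simp
next
  case (Suc k)
  define f where "f j = b ^ j * G (m + s * int (Suc k) + t * int j)" for j
  have "(\<Sum>j=0..Suc k. of_nat (Suc k choose j) * f j)
      = f 0 + (\<Sum>j=0..k. of_nat (Suc k choose Suc j) * f (Suc j))"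
    by (simp only: sum.atLeast0_atMost_Suc_shift) simp
  also have "\<dots> = (f 0 + (\<Sum>j=0..k. of_nat (k choose Suc j) * f (Suc j)))
      + (\<Sum>j=0..k. of_nat (k choose j) * f (Suc j))"
    by (simp add: sum.distrib algebra_simps)
  also have "f 0 + (\<Sum>j=0..k. of_nat (k choose Suc j) * f (Suc j))
      = (\<Sum>j=0..Suc k. of_nat (k choose j) * f j)"
    by (simp only: sum.atLeast0_atMost_Suc_shift) simp
  also have "\<dots> = (\<Sum>j=0..k. of_nat (k choose j) * f j)"
    by (simp add: binomial_eq_0)
  also have "\<dots> = c ^ k * G (m + s)"
    using Suc.IH[of "m + s"] by (simp add: f_def algebra_simps)
  also have "(\<Sum>j=0..k. of_nat (k choose j) * f (Suc j)) = b * (c ^ k * G (m + s + t))"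
    unfolding Suc.IH[of "m + s + t", symmetric] sum_distrib_left
    by (simp add: f_def algebra_simps)
  also have "c ^ k * G (m + s) + b * (c ^ k * G (m + s + t)) = c ^ k * (c * G m)"
    unfolding rel[of m, symmetric] by (simp add: algebra_simps)
  finally show ?case
    by (simp add: f_def mult_ac)
qed

theorem theorem2:
  fixes G :: "int \<Rightarrow> complex" and n m r :: int and k :: nat
  assumes "gen_fibonacci G"
  shows
    "(n + r \<noteq> 0 \<longrightarrow>
        (\<Sum>j=0..k. (-1) ^ j * of_nat (k choose j) * (fib_int r / fib_int (r + n)) ^ j
             * G (m + r * int k + n * int j))
        = (-1) powi (r * int k) * (fib_int n / fib_int (r + n)) ^ k * G m)
   \<and> (n \<noteq> 0 \<longrightarrow>
        (\<Sum>j=0..k. (-1) powi (r * int j) * of_nat (k choose j) * (fib_int r / fib_int n) ^ j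
             * G (m - r * int k + (n + r) * int j))
        = (-1) powi (r * int k) * (fib_int (n + r) / fib_int n) ^ k * G m)
   \<and> (n \<noteq> 0 \<longrightarrow>
        (\<Sum>j=0..k. (-1) ^ j * (-1) powi (r * int j) * of_nat (k choose j)
             * (fib_int (n + r) / fib_int n) ^ j
             * G (m - (n + r) * int k + r * int j))
        = (-1) ^ k * (-1) powi (r * int k) * (fib_int r / fib_int n) ^ k * G m)"
proof (intro conjI impI)
  note vajda = gen_fibonacci_vajda[OF assms]
  have sign_square: "(-1) powi r * (-1) powi r = (1 :: complex)"
    by (simp flip: power_int_mult_distrib)
  have sign_power: "(-1) powi (r * int j) = ((-1) powi r :: complex) ^ j" for j
    by (simp add: power_int_mult)
  {
    assume "n + r \<noteq> 0"
    then have nz: "fib_int (r + n) \<noteq> 0" by (simp add: fib_int_nonzero add.commute)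
    have "G (m + r) + - (fib_int r / fib_int (r + n)) * G (m + r + n)
        = (-1) powi r * (fib_int n / fib_int (r + n)) * G m" for m
      using vajda[of r n m] nz by (simp add: field_simps)
    from binomial_sum_of_three_term_relation[of G, OF this, of k m]
    show "(\<Sum>j=0..k. (-1) ^ j * of_nat (k choose j) * (fib_int r / fib_int (r + n)) ^ j
          * G (m + r * int k + n * int j))
        = (-1) powi (r * int k) * (fib_int n / fib_int (r + n)) ^ k * G m"
      unfolding sign_power power_mult_distrib
        power_minus[of "fib_int r / fib_int (r + n)"]
      by (simp only: mult_ac)
  next
    assume "n \<noteq> 0"
    then have nz: "fib_int n \<noteq> 0" by (rule fib_int_nonzero)
    have "G (m + - r) + ((-1) powi r * (fib_int r / fib_int n)) * G (m + - r + (n + r))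
        = (-1) powi r * (fib_int (n + r) / fib_int n) * G m" for m
    proof -
      \<comment> \<open>The wanted relation has the sign on the other side: multiply by
        $(-1)^r$, which is its own inverse.\<close>
      have "fib_int (n + r) * G m - fib_int r * G (m + n) = (-1) powi r * fib_int n * G (m - r)"
        using vajda[of r n "m - r"] by (simp add: add.commute)
      then have "(-1) powi r * (fib_int (n + r) * G m - fib_int r * G (m + n))
          = fib_int n * G (m - r)"
        using sign_square by (metis mult.assoc mult.left_neutral)
      then show ?thesis using nz by (simp add: field_simps)
    qed
    from binomial_sum_of_three_term_relation[of G, OF this, of k m]
    show "(\<Sum>j=0..k. (-1) powi (r * int j) * of_nat (k choose j) * (fib_int r / fib_int n) ^ j
          * G (m - r * int k + (n + r) * int j))
        = (-1) powi (r * int k) * (fib_int (n + r) / fib_int n) ^ k * G m"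
      unfolding sign_power power_mult_distrib diff_conv_add_uminus
      by (simp only: mult_ac mult_minus_left mult_minus_right)
  next
    assume "n \<noteq> 0"
    then have nz: "fib_int n \<noteq> 0" by (rule fib_int_nonzero)
    have "G (m + - (n + r)) + (- 1 * (-1) powi r * (fib_int (n + r) / fib_int n))
          * G (m + - (n + r) + r)
        = - 1 * (-1) powi r * (fib_int r / fib_int n) * G m" for m
    proof -
      have "fib_int (n + r) * G (m - n) - fib_int r * G m
          = (-1) powi r * fib_int n * G (m - (n + r))"
        using vajda[of r n "m - (n + r)"] by (simp add: algebra_simps)
      then have "(-1) powi r * (fib_int (n + r) * G (m - n) - fib_int r * G m)
          = fib_int n * G (m - (n + r))"
        using sign_square by (metis mult.assoc mult.left_neutral)
      then show ?thesis using nz by (simp add: field_simps)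
    qed
    from binomial_sum_of_three_term_relation[of G, OF this, of k m]
    show "(\<Sum>j=0..k. (-1) ^ j * (-1) powi (r * int j) * of_nat (k choose j)
          * (fib_int (n + r) / fib_int n) ^ j * G (m - (n + r) * int k + r * int j))
        = (-1) ^ k * (-1) powi (r * int k) * (fib_int r / fib_int n) ^ k * G m"
      unfolding sign_power power_mult_distrib diff_conv_add_uminus
      by (simp only: mult_ac mult_minus_left mult_minus_right)
  }
qed

end
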